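(* Let $A$ be a linear order. (1) If $A$ admits a $\mathbb{Z}$-cover, then $A^{\omega}$ has a parity-reversing automorphism. (2) If $A$ has a left endpoint and admits a $\{\mathbb{Z},\omega\}$-cover, then $A^{\omega}$ has a parity-reversing automorphism. (3) If $A$ has a right endpoint and admits a $\{\mathbb{Z},\omega^*\}$-cover, then $A^{\omega}$ has a parity-reversing automorphism. Consequently, in any of these three cases, for every linear order $X$, if $A^2X\cong X$ then $AX\cong X$.
   Context: Products are lexicographic. $A^\omega$: infinite sequences of elements of $A$ ordered lexicographically; $au$ prepends $a$ to $u$. $u\sim_2 v$ iff there are finite sequences $r,s$ with $|r|\equiv|s|\pmod 2$ and $u'$ with $u=ru'$, $v=su'$. A parity-reversing automorphism of $A^\omega$ is an order automorphism $f$ with $f(u)\sim_2 au$ for all $u\in A^\omega$, $a\in A$. An interval is a convex subset. A $\mathbb{Z}$-interval is an interval with no minimum and no maximum that has coinitiality $\omega$ and cofinality $\omega$ (i.e. it is spanned by a $\mathbb{Z}$-indexed increasing sequence unbounded in both directions within it); an $\omega$-interval has a minimum and cofinality $\omega$; an $\omega^*$-interval has a maximum and coinitiality $\omega$. A cover of $A$ is a collection of pairwise disjoint intervals whose union is $A$. It is a $\mathbb{Z}$-cover if all its members are $\mathbb{Z}$-intervals, a $\{\mathbb{Z},\omega\}$-cover if each member is a $\mathbb{Z}$-interval or an $\omega$-interval, and a $\{\mathbb{Z},\omega^*\}$-cover if each member is a $\mathbb{Z}$-interval or an $\omega^*$-interval. *)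

theory Defs
  imports
    "HOL-Library.Stream"
    "HOL-Library.Fun_Lexorder"
    "HOL-Library.Product_Lexorder"
    "HOL-Library.Disjoint_Sets"
begin

text \<open>
  A linear order is rendered as an arbitrary (possibly empty) subset \<open>A\<close> of a type of class
  \<^class>\<open>linorder\<close>. The power \<open>A\<^sup>\<omega>\<close> is \<open>streams A\<close>, the word \<open>au\<close> is \<open>a ## u\<close>, and the
  lexicographic product \<open>A X\<close> (first coordinate dominant) is \<open>A \<times> X\<close> with the order of
  \<^theory>\<open>HOL-Library.Product_Lexorder\<close>.
\<close>

instantiation stream :: (linorder) linorder
begin

definition less_stream :: "'a stream \<Rightarrow> 'a stream \<Rightarrow> bool" where
  "u < v \<longleftrightarrow> less_fun (snth u) (snth v)"

definition less_eq_stream :: "'a stream \<Rightarrow> 'a stream \<Rightarrow> bool" where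
  "u \<le> v \<longleftrightarrow> u < v \<or> u = (v :: 'a stream)"

instance
proof
  fix u v w :: "'a stream"
  show "(u < v) = (u \<le> v \<and> \<not> v \<le> u)"
    unfolding less_eq_stream_def less_stream_def
    using less_fun_asym less_fun_irrefl by blast
  show "u \<le> u"
    by (simp add: less_eq_stream_def)
  show "u \<le> v \<Longrightarrow> v \<le> w \<Longrightarrow> u \<le> w"
    unfolding less_eq_stream_def less_stream_def
    using less_fun_trans by blast
  show "u \<le> v \<Longrightarrow> v \<le> u \<Longrightarrow> u = v"
    unfolding less_eq_stream_def less_stream_def
    using less_fun_asym by blast
  show "u \<le> v \<or> v \<le> u"
  proof (cases "u = v")
    case True
    then show ?thesis by (simp add: less_eq_stream_def)
  next
    case False
    define k where "k = (LEAST k. u !! k \<noteq> v !! k)"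
    have "\<exists>k. u !! k \<noteq> v !! k"
      using False by (metis smap_alt stream.map_id)
    then have "u !! k \<noteq> v !! k"
      unfolding k_def by (rule LeastI_ex)
    moreover have "u !! k' = v !! k'" if "k' < k" for k'
      using that not_less_Least unfolding k_def by blast
    ultimately have "less_fun (snth u) (snth v) \<or> less_fun (snth v) (snth u)"
      unfolding less_fun_def by (metis linorder_neqE)
    then show ?thesis
      by (auto simp: less_eq_stream_def less_stream_def)
  qed
qed

end

definition order_iso :: "('a::linorder \<Rightarrow> 'b::linorder) \<Rightarrow> 'a set \<Rightarrow> 'b set \<Rightarrow> bool" where
  "order_iso f A B \<longleftrightarrow> bij_betw f A B \<and> (\<forall>x\<in>A. \<forall>y\<in>A. x < y \<longleftrightarrow> f x < f y)"

definition order_isomorphic :: "'a::linorder set \<Rightarrow> 'b::linorder set \<Rightarrow> bool"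
    (infix \<open>\<cong>\<^sub>o\<close> 50) where
  "A \<cong>\<^sub>o B \<longleftrightarrow> (\<exists>f. order_iso f A B)"

text \<open>
  For \<open>u, v \<in> streams A\<close>, the sequences \<open>r\<close>, \<open>s\<close> and \<open>u'\<close> below automatically have their
  entries in \<open>A\<close>.
\<close>

definition sim2 :: "'a stream \<Rightarrow> 'a stream \<Rightarrow> bool" (infix \<open>\<sim>\<^sub>2\<close> 50) where
  "u \<sim>\<^sub>2 v \<longleftrightarrow>
    (\<exists>r s u'. length r mod 2 = length s mod 2 \<and> u = r @- u' \<and> v = s @- u')"

definition parity_reversing_automorphism ::
    "'a::linorder set \<Rightarrow> ('a stream \<Rightarrow> 'a stream) \<Rightarrow> bool" where
  "parity_reversing_automorphism A f \<longleftrightarrow>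
    order_iso f (streams A) (streams A) \<and> (\<forall>u\<in>streams A. \<forall>a\<in>A. f u \<sim>\<^sub>2 a ## u)"

definition has_minimum :: "'a::linorder set \<Rightarrow> bool" where
  "has_minimum I \<longleftrightarrow> (\<exists>m\<in>I. \<forall>x\<in>I. m \<le> x)"

definition has_maximum :: "'a::linorder set \<Rightarrow> bool" where
  "has_maximum I \<longleftrightarrow> (\<exists>m\<in>I. \<forall>x\<in>I. x \<le> m)"

definition cofinality_omega :: "'a::linorder set \<Rightarrow> bool" where
  "cofinality_omega I \<longleftrightarrow>
    (\<exists>s :: nat \<Rightarrow> 'a. strict_mono s \<and> range s \<subseteq> I \<and> (\<forall>x\<in>I. \<exists>n. x \<le> s n))"

definition coinitiality_omega :: "'a::linorder set \<Rightarrow> bool" where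
  "coinitiality_omega I \<longleftrightarrow>
    (\<exists>s :: nat \<Rightarrow> 'a. strict_antimono_on UNIV s \<and> range s \<subseteq> I \<and> (\<forall>x\<in>I. \<exists>n. s n \<le> x))"

definition interval_of :: "'a::linorder set \<Rightarrow> 'a set \<Rightarrow> bool" where
  "interval_of A I \<longleftrightarrow>
    I \<subseteq> A \<and> (\<forall>x\<in>I. \<forall>y\<in>I. \<forall>z\<in>A. x \<le> z \<and> z \<le> y \<longrightarrow> z \<in> I)"

definition Z_interval :: "'a::linorder set \<Rightarrow> 'a set \<Rightarrow> bool" where
  "Z_interval A I \<longleftrightarrow> interval_of A I \<and> \<not> has_minimum I \<and> \<not> has_maximum I \<and>
    coinitiality_omega I \<and> cofinality_omega I"

definition omega_interval :: "'a::linorder set \<Rightarrow> 'a set \<Rightarrow> bool" where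
  "omega_interval A I \<longleftrightarrow> interval_of A I \<and> has_minimum I \<and> cofinality_omega I"

definition omega_star_interval :: "'a::linorder set \<Rightarrow> 'a set \<Rightarrow> bool" where
  "omega_star_interval A I \<longleftrightarrow> interval_of A I \<and> has_maximum I \<and> coinitiality_omega I"

definition cover_of :: "'a::linorder set \<Rightarrow> 'a set set \<Rightarrow> bool" where
  "cover_of A C \<longleftrightarrow> (\<forall>I\<in>C. interval_of A I) \<and> disjoint C \<and> \<Union>C = A"

definition Z_cover :: "'a::linorder set \<Rightarrow> 'a set set \<Rightarrow> bool" where
  "Z_cover A C \<longleftrightarrow> cover_of A C \<and> (\<forall>I\<in>C. Z_interval A I)"

definition Z_omega_cover :: "'a::linorder set \<Rightarrow> 'a set set \<Rightarrow> bool" where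
  "Z_omega_cover A C \<longleftrightarrow> cover_of A C \<and> (\<forall>I\<in>C. Z_interval A I \<or> omega_interval A I)"

definition Z_omega_star_cover :: "'a::linorder set \<Rightarrow> 'a set set \<Rightarrow> bool" where
  "Z_omega_star_cover A C \<longleftrightarrow>
    cover_of A C \<and> (\<forall>I\<in>C. Z_interval A I \<or> omega_star_interval A I)"

end

theory Submission
  imports Defs "HOL-Library.Dual_Ordered_Lattice"
begin

text \<open>
  Fix \<open>z \<in> A\<close> and write \<open>\<tau>\<close> for an interval \<open>[a z\<^sup>\<omega>, b z\<^sup>\<omega>)\<close> of \<open>A\<^sup>\<omega>\<close> with \<open>a < b\<close>. Count order isomorphisms
  between such intervals as even or odd according to how they change the parity of prefixes; since
  \<open>z z\<^sup>\<omega> = z\<^sup>\<omega>\<close>, endpoints carry no parity. If \<open>A\<close> has no maximum, then any \<open>\<tau>'\<close> absorbs an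
  odd copy of any \<open>\<tau>\<close> on its left: \<open>\<tau>\<^sup>- + \<tau>' \<cong> \<tau>'\<close>. A member of the cover, spanned by
  a sequence \<open>a\<^sub>n\<close>, contributes the sum of the \<open>\<tau>\<^sub>n = [a\<^sub>n z\<^sup>\<omega>, a\<^sub>n\<^sub>+\<^sub>1 z\<^sup>\<omega>)\<close>, and
  \<open>\<Sum> \<tau>\<^sub>n \<cong> \<Sum> (\<tau>\<^sub>n\<^sub>-\<^sub>1\<^sup>- + \<tau>\<^sub>n) = \<Sum> (\<tau>\<^sub>n + \<tau>\<^sub>n\<^sup>-) \<cong> \<Sum> \<tau>\<^sub>n\<^sup>-\<close>.
  For members with a minimum, \<open>z\<close> has to be the minimum of \<open>A\<close> so that \<open>a\<^sub>0 z\<^sup>\<omega>\<close> is the first point.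

  Given \<open>A\<^sup>2 X \<cong> X\<close>, expanding the points of \<open>X\<close> decomposes \<open>X\<close> into convex fibres \<open>X\<^sub>u\<close> over
  \<open>u \<in> A\<^sup>\<omega>\<close> with \<open>X\<^sub>u \<cong> X\<^sub>v\<close> whenever \<open>u \<sim>\<^sub>2 v\<close>. The fibre of \<open>A X\<close> over \<open>a u\<close> is \<open>X\<^sub>u\<close>, so a
  parity-reversing automorphism matches the fibres of \<open>X\<close> with those of \<open>A X\<close>.
\<close>

section \<open>Order isomorphisms\<close>

lemma order_isoI:
  assumes "\<And>x. x \<in> S \<Longrightarrow> f x \<in> T" "\<And>y. y \<in> T \<Longrightarrow> \<exists>x\<in>S. f x = y"
    and mono: "\<And>x y. x \<in> S \<Longrightarrow> y \<in> S \<Longrightarrow> x < y \<Longrightarrow> f x < f y"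
  shows "order_iso f S T"
proof -
  have iff: "x < y \<longleftrightarrow> f x < f y" if "x \<in> S" "y \<in> S" for x y
    using mono[OF that] mono[OF that(2,1)] by (metis less_asym less_irrefl linorder_neqE)
  then have "inj_on f S"
    by (metis inj_onI less_irrefl linorder_neqE)
  moreover have "f ` S = T"
    using assms(1,2) by blast
  ultimately show ?thesis
    using iff by (simp add: order_iso_def bij_betw_def)
qed

lemma order_isoD:
  assumes "order_iso f S T"
  shows order_iso_mem: "\<And>x. x \<in> S \<Longrightarrow> f x \<in> T"
    and order_iso_onto: "\<And>y. y \<in> T \<Longrightarrow> \<exists>x\<in>S. f x = y"
    and order_iso_less: "\<And>x y. x \<in> S \<Longrightarrow> y \<in> S \<Longrightarrow> f x < f y \<longleftrightarrow> x < y"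
  using assms unfolding order_iso_def bij_betw_def by auto

lemma order_iso_id: "order_iso (\<lambda>x. x) S S"
  by (rule order_isoI) auto

lemma order_iso_comp:
  assumes "order_iso f S T" "order_iso g T U"
  shows "order_iso (\<lambda>x. g (f x)) S U"
  by (rule order_isoI)
    (use order_isoD[OF assms(1)] order_isoD[OF assms(2)] in \<open>blast | metis\<close>)+

lemma order_iso_inv:
  assumes "order_iso f S T"
  shows "order_iso (inv_into S f) T S"
proof (rule order_isoI)
  note f = order_isoD[OF assms]
  have *: "inv_into S f y \<in> S" "f (inv_into S f y) = y" if "y \<in> T" for y
    using f(2)[OF that] by (auto intro: inv_into_into f_inv_into_f)
  show "inv_into S f y \<in> S" if "y \<in> T" for y
    by (rule *(1)[OF that])
  have "inj_on f S"
    using assms by (simp add: order_iso_def bij_betw_def)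
  then show "\<exists>y\<in>T. inv_into S f y = x" if "x \<in> S" for x
    using f(1)[OF that] inv_into_f_f that by metis
  show "inv_into S f x < inv_into S f y" if "x \<in> T" "y \<in> T" "x < y" for x y
    using that * f(3) by metis
qed

lemma order_isomorphic_refl: "S \<cong>\<^sub>o S"
  using order_iso_id unfolding order_isomorphic_def by blast

lemma order_isomorphic_sym: "S \<cong>\<^sub>o T \<Longrightarrow> T \<cong>\<^sub>o S"
  using order_iso_inv unfolding order_isomorphic_def by blast

lemma order_isomorphic_trans: "S \<cong>\<^sub>o T \<Longrightarrow> T \<cong>\<^sub>o U \<Longrightarrow> S \<cong>\<^sub>o U"
  using order_iso_comp unfolding order_isomorphic_def by blast

section \<open>The lexicographic order on streams\<close>

lemma less_stream_iff:
  "u < v \<longleftrightarrow> shd u < shd v \<or> shd u = shd v \<and> stl u < stl (v :: 'a::linorder stream)"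
proof
  assume "u < v"
  then obtain k where k: "u !! k < v !! k" "\<forall>k'<k. u !! k' = v !! k'"
    unfolding less_stream_def less_fun_def by blast
  show "shd u < shd v \<or> shd u = shd v \<and> stl u < stl v"
  proof (cases k)
    case 0
    then show ?thesis using k by simp
  next
    case (Suc j)
    have "stl u !! j < stl v !! j" using k(1) Suc by simp
    moreover have "\<forall>k'<j. stl u !! k' = stl v !! k'" using k(2) Suc by fastforce
    moreover have "shd u = shd v" using k(2) Suc by force
    ultimately show ?thesis
      unfolding less_stream_def less_fun_def by blast
  qed
next
  assume "shd u < shd v \<or> shd u = shd v \<and> stl u < stl v"
  then show "u < v"
  proof
    assume "shd u < shd v"
    then have "u !! 0 < v !! 0" by simp
    then show ?thesis unfolding less_stream_def less_fun_def by blast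
  next
    assume *: "shd u = shd v \<and> stl u < stl v"
    then obtain k where k: "stl u !! k < stl v !! k" "\<forall>k'<k. stl u !! k' = stl v !! k'"
      unfolding less_stream_def less_fun_def by blast
    have "u !! Suc k < v !! Suc k" using k by simp
    moreover have "\<forall>k'<Suc k. u !! k' = v !! k'"
      using k(2) * by (auto simp: less_Suc_eq_0_disj)
    ultimately show ?thesis unfolding less_stream_def less_fun_def by blast
  qed
qed

lemma SCons_less_iff [simp]: "a ## u < b ## v \<longleftrightarrow> a < b \<or> a = b \<and> u < (v :: 'a::linorder stream)"
  by (subst less_stream_iff) simp

lemma SCons_le_iff [simp]: "a ## u \<le> b ## v \<longleftrightarrow> a < b \<or> a = b \<and> u \<le> (v :: 'a::linorder stream)"
  by (auto simp: le_less)

lemma shd_less_imp_less: "shd u < shd v \<Longrightarrow> u < (v :: 'a::linorder stream)"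
  by (subst less_stream_iff) simp

lemma shd_le_mono: "u \<le> v \<Longrightarrow> shd u \<le> shd (v :: 'a::linorder stream)"
  by (cases u; cases v) auto

lemma shift_less_iff [simp]: "r @- u < r @- v \<longleftrightarrow> u < (v :: 'a::linorder stream)"
  by (induction r) auto

lemma shift_le_iff [simp]: "r @- u \<le> r @- v \<longleftrightarrow> u \<le> (v :: 'a::linorder stream)"
  by (induction r) auto

text \<open>Words with prefix \<open>r\<close> form a convex set, which makes prepending
  \<open>r\<close> surjective onto an interval between two such words.\<close>

lemma shift_between:
  fixes u :: "'a::linorder stream"
  assumes "r @- x \<le> u" "u < r @- y"
  shows "\<exists>w. u = r @- w"
  using assms
proof (induction r arbitrary: u)
  case (Cons a r)
  obtain b v where u: "u = b ## v" by (cases u)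
  then have "b = a" "r @- x \<le> v" "v < r @- y" using Cons.prems by auto
  then show ?case using Cons.IH[of v] u by auto
qed simp

lemma streams_shift_iff: "r @- u \<in> streams A \<longleftrightarrow> r \<in> lists A \<and> u \<in> streams A"
  by (induction r) (auto simp: streams_Stream)

section \<open>Isomorphisms that respect parity\<close>

text \<open>\<open>b = False\<close> gives the relation \<open>sim2\<close> and
  \<open>b = True\<close> its odd counterpart; parities add by exclusive or, written
  \<open>b \<noteq> c\<close>. Both values may hold at once, for instance for z^\<omega> and
  itself.\<close>

definition tail_parity :: "bool \<Rightarrow> 'a stream \<Rightarrow> 'a stream \<Rightarrow> bool" where
  "tail_parity b u v \<longleftrightarrow> (\<exists>m n. sdrop m u = sdrop n v \<and> odd (m + n) = b)"

lemma tail_parity_refl: "tail_parity False u u"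
  unfolding tail_parity_def by (rule exI[of _ 0], rule exI[of _ 0]) simp

lemma tail_parity_sym: "tail_parity b u v \<Longrightarrow> tail_parity b v u"
  unfolding tail_parity_def by (metis add.commute)

lemma tail_parity_trans:
  assumes "tail_parity b u v" "tail_parity c v w"
  shows "tail_parity (b \<noteq> c) u w"
proof -
  obtain m n k l where *: "sdrop m u = sdrop n v" "odd (m + n) = b"
      "sdrop k v = sdrop l w" "odd (k + l) = c"
    using assms unfolding tail_parity_def by blast
  \<comment> \<open>Dropping \<open>k\<close> more letters in the first equation and
    \<open>n\<close> more in the second makes both meet in \<open>sdrop (n + k) v\<close>.\<close>
  have "sdrop (m + k) u = sdrop (l + n) w"
    using *(1,3) by (metis add.commute sdrop_add)
  moreover have "odd ((m + k) + (l + n)) = (b \<noteq> c)"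
    using *(2,4) by auto
  ultimately show ?thesis
    unfolding tail_parity_def by blast
qed

lemma tail_parity_shift: "tail_parity (odd (length r)) u (r @- u)"
  unfolding tail_parity_def
  by (rule exI[of _ 0], rule exI[of _ "length r"]) (simp add: sdrop_shift)

text \<open>The letter \<open>a\<close> accounts for the change from even to odd; its value does not
  matter because tails discard it.\<close>

lemma sim2_SCons_iff: "v \<sim>\<^sub>2 a ## u \<longleftrightarrow> tail_parity True u v"
proof
  assume "tail_parity True u v"
  then obtain m n where *: "sdrop m u = sdrop n v" "odd (m + n)"
    unfolding tail_parity_def by blast
  have "v = stake n v @- sdrop m u" "a ## u = (a # stake m u) @- sdrop m u"
    using *(1) by (metis stake_sdrop, metis shift.simps(2) stake_sdrop)
  moreover have "length (stake n v) mod 2 = length (a # stake m u) mod 2"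
    using *(2) by (simp, presburger)
  ultimately show "v \<sim>\<^sub>2 a ## u"
    unfolding sim2_def by blast
next
  assume "v \<sim>\<^sub>2 a ## u"
  then obtain r s t where *: "length r mod 2 = length s mod 2" "v = r @- t" "a ## u = s @- t"
    unfolding sim2_def by blast
  \<comment> \<open>One letter beyond \<open>s\<close> and \<open>r\<close> is dropped, so that
    \<open>a\<close> is gone even if \<open>s\<close> is empty.\<close>
  have "sdrop (length s) u = sdrop (Suc (length s)) (a ## u)" by simp
  also have "\<dots> = stl t" using *(3) by (simp add: sdrop_shift sdrop_stl)
  also have "\<dots> = sdrop (Suc (length r)) v" using *(2) by (simp add: sdrop_shift sdrop_stl)
  finally have "sdrop (length s) u = sdrop (Suc (length r)) v" .
  moreover have "odd (length s + Suc (length r))" using *(1) by presburger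
  ultimately show "tail_parity True u v" unfolding tail_parity_def by blast
qed

definition parity_iso :: "bool \<Rightarrow> 'a::linorder stream set \<Rightarrow> 'a stream set \<Rightarrow> bool" where
  "parity_iso b S T \<longleftrightarrow> (\<exists>f. order_iso f S T \<and> (\<forall>u\<in>S. tail_parity b u (f u)))"

lemma parity_iso_refl: "parity_iso False S S"
  unfolding parity_iso_def using order_iso_id tail_parity_refl by blast

lemma parity_iso_sym:
  assumes "parity_iso b S T"
  shows "parity_iso b T S"
proof -
  obtain f where f: "order_iso f S T" "\<forall>u\<in>S. tail_parity b u (f u)"
    using assms unfolding parity_iso_def by blast
  have "tail_parity b v (inv_into S f v)" if "v \<in> T" for v
    using f(2) order_iso_mem[OF order_iso_inv[OF f(1)] that] order_iso_onto[OF f(1) that]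
      tail_parity_sym by (metis f_inv_into_f imageI)
  then show ?thesis
    using order_iso_inv[OF f(1)] unfolding parity_iso_def by blast
qed

lemma parity_iso_trans:
  assumes "parity_iso b S T" "parity_iso c T U"
  shows "parity_iso (b \<noteq> c) S U"
proof -
  obtain f g where f: "order_iso f S T" "\<forall>u\<in>S. tail_parity b u (f u)"
    and g: "order_iso g T U" "\<forall>u\<in>T. tail_parity c u (g u)"
    using assms unfolding parity_iso_def by blast
  have "\<forall>u\<in>S. tail_parity (b \<noteq> c) u (g (f u))"
    using f g order_iso_mem[OF f(1)] tail_parity_trans by blast
  then show ?thesis
    using order_iso_comp[OF f(1) g(1)] unfolding parity_iso_def by blast
qed

text \<open>The index set carries no order: \<open>sep\<close> compares the pieces directly and asks
  that any two lie in the same order on both sides, so the piecewise map is increasing.\<close>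

lemma parity_iso_UN:
  assumes iso: "\<And>k. k \<in> K \<Longrightarrow> parity_iso b (S k) (T k)"
    and sep: "\<And>k l. k \<in> K \<Longrightarrow> l \<in> K \<Longrightarrow> k \<noteq> l \<Longrightarrow>
      (\<forall>u\<in>S k. \<forall>v\<in>S l. u < v) \<and> (\<forall>u\<in>T k. \<forall>v\<in>T l. u < v) \<or>
      (\<forall>u\<in>S k. \<forall>v\<in>S l. v < u) \<and> (\<forall>u\<in>T k. \<forall>v\<in>T l. v < u)"
  shows "parity_iso b (\<Union>k\<in>K. S k) (\<Union>k\<in>K. T k)"
proof -
  obtain f where f: "\<And>k. k \<in> K \<Longrightarrow> order_iso (f k) (S k) (T k)"
    and fp: "\<And>k u. k \<in> K \<Longrightarrow> u \<in> S k \<Longrightarrow> tail_parity b u (f k u)"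
    using iso unfolding parity_iso_def by metis
  define idx where "idx u = (SOME k. k \<in> K \<and> u \<in> S k)" for u
  \<comment> \<open>Separated pieces are disjoint, so the choice made by \<open>idx\<close> is
    forced.\<close>
  have idx: "idx u = k" if "k \<in> K" "u \<in> S k" for u k
  proof -
    have "idx u \<in> K \<and> u \<in> S (idx u)"
      unfolding idx_def by (rule someI[of _ k]) (use that in blast)
    then show ?thesis using sep[of "idx u" k] that by (metis less_irrefl)
  qed
  define g where "g u = f (idx u) u" for u
  have g: "g u = f k u" if "k \<in> K" "u \<in> S k" for u k
    using idx[OF that] by (simp add: g_def)
  have "order_iso g (\<Union>k\<in>K. S k) (\<Union>k\<in>K. T k)"
  proof (rule order_isoI)
    show "g u \<in> (\<Union>k\<in>K. T k)" if "u \<in> (\<Union>k\<in>K. S k)" for u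
      using that g order_iso_mem[OF f] by fastforce
    show "\<exists>u\<in>(\<Union>k\<in>K. S k). g u = v" if v: "v \<in> (\<Union>k\<in>K. T k)" for v
    proof -
      obtain k where k: "k \<in> K" "v \<in> T k" using v by blast
      then obtain u where "u \<in> S k" "f k u = v" using order_iso_onto[OF f] by blast
      then show ?thesis using g k by blast
    qed
    show "g u < g v"
      if uv: "u \<in> (\<Union>k\<in>K. S k)" "v \<in> (\<Union>k\<in>K. S k)" "u < v" for u v
    proof -
      obtain k l where kl: "k \<in> K" "u \<in> S k" "l \<in> K" "v \<in> S l" using uv by blast
      then have m: "g u \<in> T k" "g v \<in> T l" using g order_iso_mem[OF f] by auto
      show ?thesis
      proof (cases "k = l")
        case True
        then show ?thesis using kl g order_iso_less[OF f] uv(3) by auto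
      next
        case False
        then show ?thesis using sep[of k l] kl m uv(3) by (meson less_asym)
      qed
    qed
  qed
  moreover have "\<forall>u\<in>(\<Union>k\<in>K. S k). tail_parity b u (g u)"
    using g fp by auto
  ultimately show ?thesis unfolding parity_iso_def by blast
qed

lemma parity_iso_Un:
  assumes "parity_iso b S T" "parity_iso b S' T'"
    and "\<And>u v. u \<in> S \<Longrightarrow> v \<in> S' \<Longrightarrow> u < v" "\<And>u v. u \<in> T \<Longrightarrow> v \<in> T' \<Longrightarrow> u < v"
  shows "parity_iso b (S \<union> S') (T \<union> T')"
proof -
  have "parity_iso b (\<Union>k\<in>UNIV. if k then S else S') (\<Union>k\<in>UNIV. if k then T else T')"
    by (rule parity_iso_UN) (use assms in auto)
  then show ?thesis by (simp add: UNIV_bool Un_commute)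
qed

text \<open>Half-open, so that intervals with a common endpoint tile without overlap.\<close>

definition stream_interval :: "'a::linorder set \<Rightarrow> 'a stream \<Rightarrow> 'a stream \<Rightarrow> 'a stream set" where
  "stream_interval A x y = {u \<in> streams A. x \<le> u \<and> u < y}"

lemma stream_interval_Un:
  "x \<le> y \<Longrightarrow> y \<le> w \<Longrightarrow> stream_interval A x y \<union> stream_interval A y w = stream_interval A x w"
  by (auto simp: stream_interval_def)

lemma stream_interval_empty: "stream_interval A x x = {}"
  by (auto simp: stream_interval_def)

lemma parity_iso_concat:
  assumes "parity_iso b (stream_interval A x y) (stream_interval A x' y')"
    and "parity_iso b (stream_interval A y w) (stream_interval A y' w')"
    and "x \<le> y" "y \<le> w" "x' \<le> y'" "y' \<le> w'"
  shows "parity_iso b (stream_interval A x w) (stream_interval A x' w')"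
proof -
  have "parity_iso b (stream_interval A x y \<union> stream_interval A y w)
      (stream_interval A x' y' \<union> stream_interval A y' w')"
    by (rule parity_iso_Un[OF assms(1,2)]) (auto simp: stream_interval_def)
  then show ?thesis using assms(3-) by (simp add: stream_interval_Un)
qed

lemma parity_iso_shift:
  assumes "r \<in> lists A" "b = odd (length r)"
  shows "parity_iso b (stream_interval A x y) (stream_interval A (r @- x) (r @- y))"
proof -
  have "order_iso ((@-) r) (stream_interval A x y) (stream_interval A (r @- x) (r @- y))"
  proof (rule order_isoI)
    show "r @- u \<in> stream_interval A (r @- x) (r @- y)" if "u \<in> stream_interval A x y" for u
      using that assms(1) by (simp add: stream_interval_def streams_shift_iff)
    show "\<exists>u\<in>stream_interval A x y. r @- u = v"
      if v: "v \<in> stream_interval A (r @- x) (r @- y)" for v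
    proof -
      obtain w where w: "v = r @- w"
        using v shift_between[of r x v y] by (auto simp: stream_interval_def)
      then have "w \<in> stream_interval A x y"
        using v by (simp add: stream_interval_def streams_shift_iff)
      then show ?thesis using w by blast
    qed
  qed simp
  then show ?thesis
    using tail_parity_shift assms(2) unfolding parity_iso_def by blast
qed

section \<open>Absorption\<close>

text \<open>
  Prepending \<open>r\<close> pushes the points below some \<open>r\<^sup>n x\<close> upwards and the remaining points stay fixed,
  so that \<open>[x, t)\<close> swallows the initial piece \<open>[x, r x)\<close>.
\<close>

lemma parity_iso_absorb_prefix:
  assumes r: "r \<in> lists A" "even (length r)"
    and x: "x \<le> r @- x" "x < t" and t: "r @- t \<le> t"
  shows "parity_iso False (stream_interval A x t) (stream_interval A (r @- x) t)"
proof -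
  define p where "p n = (((@-) r) ^^ n) x" for n
  have p0: "p 0 = x" and pS: "p (Suc n) = r @- p n" for n by (simp_all add: p_def)
  \<comment> \<open>The orbit of \<open>x\<close> under prepending \<open>r\<close> never reaches
    \<open>t\<close>, since \<open>r @- t \<le> t\<close>.\<close>
  have pt: "p n < t" for n
  proof (induction n)
    case (Suc n)
    then have "r @- p n < r @- t" by simp
    then show ?case using t pS by (metis less_le_trans)
  qed (use x p0 in simp)
  define D where "D = {u. \<exists>n. u < p n}"
  define f where "f u = (if u \<in> D then r @- u else u)" for u
  have "order_iso f (stream_interval A x t) (stream_interval A (r @- x) t)"
  proof (rule order_isoI)
    show "f u \<in> stream_interval A (r @- x) t" if "u \<in> stream_interval A x t" for u
    proof (cases "u \<in> D")
      case True
      have "r @- u < r @- t" using that by (simp add: stream_interval_def)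
      then have "r @- u < t" using t by (rule less_le_trans)
      then show ?thesis
        using True that r(1) by (simp add: f_def stream_interval_def streams_shift_iff)
    next
      case False
      then have "p (Suc 0) \<le> u" by (auto simp: D_def not_less)
      then show ?thesis using False that by (simp add: f_def stream_interval_def pS p0)
    qed
    show "\<exists>u\<in>stream_interval A x t. f u = v" if v: "v \<in> stream_interval A (r @- x) t" for v
    proof (cases "v \<in> D")
      case True
      then obtain n where n: "v < p n" by (auto simp: D_def)
      have rv: "r @- x \<le> v" using v by (simp add: stream_interval_def)
      \<comment> \<open>For \<open>n = 0\<close> the point \<open>v\<close> would lie below
        \<open>x\<close>, yet it is at least \<open>r @- x\<close>. So \<open>v\<close> lies between
        \<open>r @- x\<close> and \<open>r @- p m\<close> and begins with \<open>r\<close>.\<close>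
      then have "n \<noteq> 0" using n x(1) p0 by (metis le_less_trans less_irrefl order.trans)
      then obtain m where m: "n = Suc m" using not0_implies_Suc by blast
      then obtain w where w: "v = r @- w"
        using shift_between[of r x v "p m"] rv n pS by auto
      have "w < p m" "x \<le> w" using n m pS w rv by simp_all
      then have "w \<in> D" "w \<in> stream_interval A x t"
        using v w pt[of m] by (auto simp: D_def stream_interval_def streams_shift_iff)
      then show ?thesis using w by (auto simp: f_def)
    next
      case False
      then have "v \<in> stream_interval A x t"
        using v x(1) by (auto simp: stream_interval_def)
      then show ?thesis using False by (auto simp: f_def)
    qed
    show "f u < f v" if "u < v" for u v
    proof (cases "v \<in> D")
      case True
      then have "u \<in> D" using \<open>u < v\<close> unfolding D_def using less_trans by blast
      then show ?thesis using True \<open>u < v\<close> by (simp add: f_def)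
    next
      case False
      show ?thesis
      proof (cases "u \<in> D")
        case True
        then obtain n where "u < p n" by (auto simp: D_def)
        \<comment> \<open>A shifted point is below the next orbit point, while no fixed point is
          below any orbit point.\<close>
        then have "r @- u < p (Suc n)" using pS by simp
        also have "\<dots> \<le> v" using False by (auto simp: D_def not_less)
        finally show ?thesis using True False by (simp add: f_def)
      next
        case False': False
        then show ?thesis using False \<open>u < v\<close> by (simp add: f_def)
      qed
    qed
  qed
  moreover have "tail_parity False u (f u)" for u
    using tail_parity_shift[of r u] r(2) tail_parity_refl by (auto simp: f_def)
  ultimately show ?thesis unfolding parity_iso_def by blast
qed

section \<open>Words ending in z^\<omega> and the intervals between them\<close>

lemma sconst_SCons: "sconst z = z ## sconst z"
  by (subst siterate.ctr) simp

lemma sconst_le: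
  assumes "u \<in> streams A" "\<And>x. x \<in> A \<Longrightarrow> z \<le> (x :: 'a::linorder)"
  shows "sconst z \<le> u"
proof (rule ccontr)
  assume "\<not> sconst z \<le> u"
  then have "u < sconst z" by simp
  then obtain k where "u !! k < z"
    unfolding less_stream_def less_fun_def by auto
  moreover have "u !! k \<in> A"
    using assms(1) by (metis snth_in)
  ultimately show False using assms(2) by (metis not_le)
qed

definition pad :: "'a \<Rightarrow> 'a list \<Rightarrow> 'a stream" where
  "pad z w = w @- sconst z"

lemma pad_Nil_eq: "pad z [] = pad z [z]"
  by (simp add: pad_def sconst_SCons[symmetric])

lemma pad_Cons: "pad z (a # w) = a ## pad z w"
  by (simp add: pad_def)

lemma pad_Nil_le_iff: "pad z [] \<le> a ## u \<longleftrightarrow> z < a \<or> z = a \<and> pad z [] \<le> (u :: 'a::linorder stream)"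
  by (subst pad_Nil_eq) (simp add: pad_Cons)

lemma pad_Nil_less_iff: "pad z [] < a ## u \<longleftrightarrow> z < a \<or> z = a \<and> pad z [] < (u :: 'a::linorder stream)"
  by (subst pad_Nil_eq) (simp add: pad_Cons)

text \<open>Supplies the odd copy of \<tau> that is to be absorbed. Prepending \<open>x\<close> to
  [a z^\<omega>, b z^\<omega>) is odd, absorption extends the result down to z^\<omega>, and the
  even prefix \<open>[c, z]\<close> moves its start to c z z^\<omega> = c z^\<omega>.\<close>

lemma parity_iso_pad_initial:
  assumes "z \<in> A" "x \<in> A" "a \<in> A" "b \<in> A" "c \<in> A" "z < x" "a < (b :: 'a::linorder)"
  shows "parity_iso True (stream_interval A (pad z [a]) (pad z [b]))
    (stream_interval A (pad z [c]) (pad z [c, z, x, b]))"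
proof -
  have 1: "parity_iso True (stream_interval A (pad z [a]) (pad z [b]))
      (stream_interval A (pad z [x, a]) (pad z [x, b]))"
    using parity_iso_shift[of "[x]" A True "pad z [a]" "pad z [b]"] assms by (simp add: pad_Cons)
  \<comment> \<open>The prefix \<open>[x, a]\<close> is even and takes z^\<omega> to the left end x
    a z^\<omega>; the condition at the right end comes from \<open>a < b\<close>.\<close>
  have 2: "parity_iso False (stream_interval A (pad z []) (pad z [x, b]))
      (stream_interval A (pad z [x, a]) (pad z [x, b]))"
    using parity_iso_absorb_prefix[of "[x, a]" A "pad z []" "pad z [x, b]"] assms
    by (simp add: pad_Cons pad_Nil_le_iff pad_Nil_less_iff)
  have 3: "parity_iso False (stream_interval A (pad z []) (pad z [x, b]))
      (stream_interval A (pad z [c]) (pad z [c, z, x, b]))"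
    using parity_iso_shift[of "[c, z]" A False "pad z []" "pad z [x, b]"] assms
    by (simp add: pad_Cons pad_Nil_eq[of z, unfolded pad_Cons, symmetric])
  show ?thesis
    using parity_iso_trans[OF parity_iso_trans[OF 1 parity_iso_sym[OF 2]] 3] by simp
qed

text \<open>The odd copy from \<open>parity_iso_pad_initial\<close> can be cut off without changing
  the even type: behind the letter \<open>c\<close>, the interval [z^\<omega>, x z^\<omega>) absorbs
  it, and all points from c x z^\<omega> on stay fixed.\<close>

lemma parity_iso_pad_final:
  assumes "z \<in> A" "x \<in> A" "b \<in> A" "c \<in> A" "z < x" "c < (d :: 'a::linorder)"
  shows "parity_iso False (stream_interval A (pad z [c]) (pad z [d]))
    (stream_interval A (pad z [c, z, x, b]) (pad z [d]))"
proof -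
  \<comment> \<open>The last \<open>z\<close> of the prefix only makes its length even; it
    disappears in z^\<omega>.\<close>
  have "parity_iso False (stream_interval A (pad z []) (pad z [x]))
      (stream_interval A (pad z [z, x, b, z]) (pad z [x]))"
    using parity_iso_absorb_prefix[of "[z, x, b, z]" A "pad z []" "pad z [x]"] assms
    by (simp add: pad_Cons pad_Nil_le_iff pad_Nil_less_iff)
  moreover have "pad z [z, x, b, z] = pad z [z, x, b]"
    by (simp add: pad_Cons pad_Nil_eq[of z, unfolded pad_Cons, symmetric])
  ultimately have *: "parity_iso False (stream_interval A (pad z []) (pad z [x]))
      (stream_interval A (pad z [z, x, b]) (pad z [x]))" by simp
  have shift: "parity_iso True (stream_interval A u v) (stream_interval A (c ## u) (c ## v))" for u v
    using parity_iso_shift[of "[c]" A True u v] assms by simp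
  have "parity_iso False (stream_interval A (pad z [c]) (pad z [c, x]))
      (stream_interval A (pad z [c, z, x, b]) (pad z [c, x]))"
    using parity_iso_trans[OF parity_iso_trans[OF parity_iso_sym[OF shift] *] shift]
    by (simp add: pad_Cons)
  then show ?thesis
    by (rule parity_iso_concat[OF _ parity_iso_refl])
      (use assms in \<open>auto simp: pad_Cons pad_Nil_le_iff\<close>)
qed

text \<open>With \<tau> = [a z^\<omega>, b z^\<omega>), the source is a copy of \<tau> followed by
  the odd copy of \<tau> starting at b z^\<omega>; the target is \<tau> cut into an odd and an even
  copy of itself. Corresponding halves differ by an odd isomorphism. The point \<open>y\<close> will
  be a z^\<omega> at the start of an \<omega>-interval, and otherwise the end of the preceding odd
  copy.\<close>

lemma parity_iso_pad_block:
  assumes A: "z \<in> A" "x \<in> A" "a \<in> A" "b \<in> A" "z < x" "a < (b :: 'a::linorder)"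
    and y: "parity_iso False (stream_interval A (pad z [a]) (pad z [b]))
      (stream_interval A y (pad z [b]))" "y \<le> pad z [b]"
  shows "parity_iso True (stream_interval A y (pad z [b, z, x, b]))
    (stream_interval A (pad z [a]) (pad z [b]))"
proof (rule parity_iso_concat)
  show "parity_iso True (stream_interval A y (pad z [b]))
      (stream_interval A (pad z [a]) (pad z [a, z, x, b]))"
    using parity_iso_trans[OF parity_iso_sym[OF y(1)] parity_iso_pad_initial[of z A x a b a]] A
    by simp
  show "parity_iso True (stream_interval A (pad z [b]) (pad z [b, z, x, b]))
      (stream_interval A (pad z [a, z, x, b]) (pad z [b]))"
    using parity_iso_trans[OF parity_iso_sym[OF parity_iso_pad_initial[of z A x a b b]]
        parity_iso_pad_final[of z A x b a b]] A
    by simp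
qed (use A y in \<open>auto simp: pad_Cons pad_Nil_le_iff\<close>)

section \<open>Gluing over a cover\<close>

text \<open>Monotone sequences may repeat endpoints; the resulting empty blocks fill the negative
  indices for an \<omega>-interval.\<close>

lemma UN_stream_interval_int:
  fixes s :: "int \<Rightarrow> 'a::linorder stream"
  assumes "mono s"
  shows "(\<Union>n. stream_interval A (s n) (s (n + 1))) =
    {u \<in> streams A. (\<exists>m. s m \<le> u) \<and> (\<exists>n. u < s n)}" (is "_ = ?R")
proof
  show "?R \<subseteq> (\<Union>n. stream_interval A (s n) (s (n + 1)))"
  proof
    fix u assume "u \<in> ?R"
    then obtain m n where u: "u \<in> streams A" "s m \<le> u" "u < s n" by blast
    then have "s m < s n" by simp
    then have "m < n" using assms by (meson monoD not_le)
    \<comment> \<open>Counting from \<open>m\<close>, the first endpoint above \<open>u\<close> is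
      at least one step away, and \<open>u\<close> lies in the block just before it.\<close>
    define j where "j = (LEAST j. u < s (m + int j))"
    have "u < s (m + int (nat (n - m)))" using u \<open>m < n\<close> by simp
    then have j: "u < s (m + int j)" unfolding j_def by (rule LeastI)
    then have "j \<noteq> 0" using u(2) by (metis add_0_right leD of_nat_0)
    then obtain i where i: "j = Suc i" using not0_implies_Suc by blast
    then have "\<not> u < s (m + int i)" using not_less_Least[of i "\<lambda>j. u < s (m + int j)"] j_def by simp
    then have "u \<in> stream_interval A (s (m + int i)) (s (m + int i + 1))"
      using j i u(1) by (simp add: stream_interval_def not_less ac_simps)
    then show "u \<in> (\<Union>n. stream_interval A (s n) (s (n + 1)))" by blast
  qed
qed (auto simp: stream_interval_def)

lemma parity_iso_int_blocks:
  fixes s t :: "int \<Rightarrow> 'a::linorder stream"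
  assumes s: "mono s" and t: "mono t"
    and "\<And>n. parity_iso b (stream_interval A (s n) (s (n + 1))) (stream_interval A (t n) (t (n + 1)))"
  shows "parity_iso b {u \<in> streams A. (\<exists>m. s m \<le> u) \<and> (\<exists>n. u < s n)}
    {u \<in> streams A. (\<exists>m. t m \<le> u) \<and> (\<exists>n. u < t n)}"
proof -
  have sep: "u < v"
    if "mono r" "u \<in> stream_interval A (r k) (r (k + 1))" "v \<in> stream_interval A (r l) (r (l + 1))"
      "k < l" for r :: "int \<Rightarrow> 'a stream" and u v k l
  proof -
    have "r (k + 1) \<le> r l" using that by (intro monoD[OF that(1)]) simp
    then show ?thesis using that by (auto simp: stream_interval_def)
  qed
  have "parity_iso b (\<Union>n. stream_interval A (s n) (s (n + 1)))
      (\<Union>n. stream_interval A (t n) (t (n + 1)))"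
  proof (rule parity_iso_UN)
    fix k l :: int
    assume "k \<noteq> l"
    then consider "k < l" | "l < k" by linarith
    then show "(\<forall>u\<in>stream_interval A (s k) (s (k + 1)). \<forall>v\<in>stream_interval A (s l) (s (l + 1)). u < v) \<and>
        (\<forall>u\<in>stream_interval A (t k) (t (k + 1)). \<forall>v\<in>stream_interval A (t l) (t (l + 1)). u < v) \<or>
        (\<forall>u\<in>stream_interval A (s k) (s (k + 1)). \<forall>v\<in>stream_interval A (s l) (s (l + 1)). v < u) \<and>
        (\<forall>u\<in>stream_interval A (t k) (t (k + 1)). \<forall>v\<in>stream_interval A (t l) (t (l + 1)). v < u)"
      using sep[OF s] sep[OF t] by cases blast+
  qed (use assms in simp)
  then show ?thesis by (simp add: UN_stream_interval_int[OF s] UN_stream_interval_int[OF t])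
qed

lemma Z_interval_sequence:
  fixes I :: "'a::linorder set"
  assumes "Z_interval A I"
  obtains a :: "int \<Rightarrow> 'a"
  where "strict_mono a" "range a \<subseteq> I" "\<And>y. y \<in> I \<Longrightarrow> \<exists>m. a m < y" "\<And>y. y \<in> I \<Longrightarrow> \<exists>n. y < a n"
proof -
  obtain c :: "nat \<Rightarrow> 'a" where c: "strict_mono c" "range c \<subseteq> I" "\<forall>y\<in>I. \<exists>n. y \<le> c n"
    using assms unfolding Z_interval_def cofinality_omega_def by blast
  obtain d :: "nat \<Rightarrow> 'a" where d: "strict_antimono_on UNIV d" "range d \<subseteq> I" "\<forall>y\<in>I. \<exists>n. d n \<le> y"
    using assms unfolding Z_interval_def coinitiality_omega_def by blast
  have dd: "d n < d m" if "m < n" for m n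
    using d(1) that by (simp add: monotone_on_def)
  have cc: "c m < c n" if "m < n" for m n
    using c(1) that by (simp add: strict_mono_def)
  obtain N where N: "d 0 \<le> c N" using c(3) d(2) by blast
  \<comment> \<open>On the negative side \<open>d\<close> is used from index 1 on, so the junction
    is strict: \<open>d 1 < d 0 \<le> c N\<close>.\<close>
  define a where "a n = (if n \<ge> 0 then c (N + nat n) else d (nat (- n)))" for n :: int
  have "strict_mono a"
  proof (rule strict_monoI)
    fix m n :: int assume "m < n"
    have "d (nat (- m)) < c (N + nat n)" if "m < 0" "n \<ge> 0"
    proof -
      have "d (nat (- m)) < d 0" using that dd by simp
      also have "d 0 \<le> c N" by (rule N)
      also have "c N \<le> c (N + nat n)" using c(1) by (simp add: strict_mono_less_eq)
      finally show ?thesis .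
    qed
    then show "a m < a n" using \<open>m < n\<close> cc dd by (auto simp: a_def)
  qed
  moreover have "range a \<subseteq> I" using c(2) d(2) by (auto simp: a_def)
  moreover have "\<exists>m. a m < y" if "y \<in> I" for y
  proof -
    obtain n where "d n \<le> y" using d(3) \<open>y \<in> I\<close> by blast
    then have "d (Suc n) < y" using dd[of n "Suc n"] by simp
    then have "a (- int (Suc n)) < y" by (simp add: a_def del: of_nat_Suc)
    then show ?thesis by blast
  qed
  moreover have "\<exists>n. y < a n" if "y \<in> I" for y
  proof -
    obtain n where "y \<le> c n" using c(3) \<open>y \<in> I\<close> by blast
    also have "c n < c (N + Suc n)" using cc by simp
    also have "\<dots> = a (int (Suc n))" by (simp add: a_def del: of_nat_Suc)
    finally show ?thesis by blast
  qed
  ultimately show ?thesis by (rule that)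
qed

section \<open>Cylinders: the part of A^\<omega> over one member of the cover\<close>

definition cylinder :: "'a set \<Rightarrow> 'a set \<Rightarrow> 'a stream set" where
  "cylinder A I = {u \<in> streams A. shd u \<in> I}"

lemma shd_in: "u \<in> streams A \<Longrightarrow> shd u \<in> A"
  by (cases u) (simp add: streams_Stream)

text \<open>The cylinder is tiled twice: \<open>t\<close> cuts it into the \<tau>_n, and
  \<open>s\<close> cuts behind the odd copy of \<tau>_(n-1) at the start of \<tau>_n. The block
  lemma maps each block of \<open>s\<close> oddly onto the block of \<open>t\<close> with the same
  index.\<close>

lemma parity_iso_cylinder_Z:
  assumes zx: "z \<in> A" "x \<in> A" "z < x" and I: "Z_interval A (I :: 'a::linorder set)"
  shows "parity_iso True (cylinder A I) (cylinder A I)"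
proof -
  obtain a :: "int \<Rightarrow> 'a" where a: "strict_mono a" "range a \<subseteq> I"
    "\<And>y. y \<in> I \<Longrightarrow> \<exists>m. a m < y" "\<And>y. y \<in> I \<Longrightarrow> \<exists>n. y < a n"
    using Z_interval_sequence[OF I] by metis
  have IA: "I \<subseteq> A" and conv: "\<And>p q y. p \<in> I \<Longrightarrow> q \<in> I \<Longrightarrow> y \<in> A \<Longrightarrow> p \<le> y \<Longrightarrow> y \<le> q \<Longrightarrow> y \<in> I"
    using I unfolding Z_interval_def interval_of_def by blast+
  have aI: "a n \<in> I" and aA: "a n \<in> A" for n using a(2) IA by auto
  \<comment> \<open>Only the first letters of the endpoints matter, since the \<open>a n\<close> are
    unbounded in \<open>I\<close> on both sides.\<close>
  have cyl: "{u \<in> streams A. (\<exists>m. s m \<le> u) \<and> (\<exists>n. u < s n)} = cylinder A I"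
    if s: "\<And>n. shd (s n) = a n" for s :: "int \<Rightarrow> 'a stream"
  proof (intro set_eqI iffI)
    fix u assume "u \<in> {u \<in> streams A. (\<exists>m. s m \<le> u) \<and> (\<exists>n. u < s n)}"
    then obtain m n where u: "u \<in> streams A" "s m \<le> u" "u \<le> s n" by (auto dest: less_imp_le)
    then have "a m \<le> shd u" "shd u \<le> a n" using shd_le_mono s by metis+
    then show "u \<in> cylinder A I" using conv[OF aI aI shd_in[OF u(1)]] u(1) by (simp add: cylinder_def)
  next
    fix u assume u: "u \<in> cylinder A I"
    then obtain m n where "a m < shd u" "shd u < a n" using a(3,4)[of "shd u"] by (auto simp: cylinder_def)
    then have "s m < u" "u < s n" by (simp_all add: shd_less_imp_less s)
    then show "u \<in> {u \<in> streams A. (\<exists>m. s m \<le> u) \<and> (\<exists>n. u < s n)}"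
      using u by (auto simp: cylinder_def intro: less_imp_le)
  qed
  define s where "s n = pad z [a n, z, x, a n]" for n
  define t where "t n = pad z [a n]" for n
  have "mono s" "mono t"
    using a(1) by (auto intro!: monoI simp: s_def t_def pad_Cons strict_mono_less strict_mono_eq le_less)
  moreover have "parity_iso True (stream_interval A (s n) (s (n + 1))) (stream_interval A (t n) (t (n + 1)))"
    for n
    unfolding s_def t_def
    by (rule parity_iso_pad_block[OF zx(1,2) aA aA zx(3) _ parity_iso_pad_final])
      (use a(1) aA zx in \<open>auto simp: strict_mono_less pad_Cons\<close>)
  ultimately have "parity_iso True {u \<in> streams A. (\<exists>m. s m \<le> u) \<and> (\<exists>n. u < s n)}
      {u \<in> streams A. (\<exists>m. t m \<le> u) \<and> (\<exists>n. u < t n)}"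
    by (rule parity_iso_int_blocks)
  moreover have "shd (s n) = a n" "shd (t n) = a n" for n by (simp_all add: s_def t_def pad_Cons)
  ultimately show ?thesis by (simp add: cyl)
qed

text \<open>As for a Z-interval, but with a first block starting at i z^\<omega>, which is the least
  point of the cylinder because \<open>z\<close> is the minimum of \<open>A\<close>.\<close>

lemma parity_iso_cylinder_omega:
  assumes zx: "z \<in> A" "x \<in> A" "z < x" and min: "\<And>y. y \<in> A \<Longrightarrow> z \<le> y"
    and I: "omega_interval A (I :: 'a::linorder set)"
  shows "parity_iso True (cylinder A I) (cylinder A I)"
proof -
  obtain c :: "nat \<Rightarrow> 'a" where c: "strict_mono c" "range c \<subseteq> I" "\<forall>y\<in>I. \<exists>n. y \<le> c n"
    using I unfolding omega_interval_def cofinality_omega_def by blast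
  obtain i where i: "i \<in> I" "\<And>y. y \<in> I \<Longrightarrow> i \<le> y"
    using I unfolding omega_interval_def has_minimum_def by blast
  have IA: "I \<subseteq> A" and conv: "\<And>p q y. p \<in> I \<Longrightarrow> q \<in> I \<Longrightarrow> y \<in> A \<Longrightarrow> p \<le> y \<Longrightarrow> y \<le> q \<Longrightarrow> y \<in> I"
    using I unfolding omega_interval_def interval_of_def by blast+
  \<comment> \<open>Nonpositive indices repeat \<open>i\<close>. The sequence \<open>c\<close>
    enters at index 1, so that \<open>i \<le> c 0 < c 1\<close> makes the first block
    proper.\<close>
  define a where "a n = (if n \<le> 0 then i else c (nat n))" for n :: int
  have aI: "a n \<in> I" and aA: "a n \<in> A" for n using c(2) i(1) IA by (auto simp: a_def)
  have a0: "a n = i" if "n \<le> 0" for n using that by (simp add: a_def)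
  have a_less: "a m < a n" if "m < n" "0 < n" for m n
  proof (cases "m \<le> 0")
    case True
    have "i \<le> c 0" using i(2) c(2) by auto
    also have "c 0 < c (nat n)" using c(1) that by (simp add: strict_mono_less)
    finally show ?thesis using True that by (simp add: a_def)
  next
    case False
    then show ?thesis using c(1) that by (simp add: a_def strict_mono_less)
  qed
  have cyl: "{u \<in> streams A. (\<exists>m. s m \<le> u) \<and> (\<exists>n. u < s n)} = cylinder A I"
    if s: "\<And>n. shd (s n) = a n" "s 0 = pad z [i]" for s :: "int \<Rightarrow> 'a stream"
  proof (intro set_eqI iffI)
    fix u assume "u \<in> {u \<in> streams A. (\<exists>m. s m \<le> u) \<and> (\<exists>n. u < s n)}"
    then obtain m n where u: "u \<in> streams A" "s m \<le> u" "u \<le> s n" by (auto dest: less_imp_le)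
    then have "a m \<le> shd u" "shd u \<le> a n" using shd_le_mono s by metis+
    then show "u \<in> cylinder A I" using conv[OF aI aI shd_in[OF u(1)]] u(1) by (simp add: cylinder_def)
  next
    fix u assume u: "u \<in> cylinder A I"
    then obtain n where "shd u \<le> c n" using c(3) by (auto simp: cylinder_def)
    also have "c n < a (int (Suc n))" using c(1) by (simp add: a_def strict_mono_less)
    finally have "u < s (int (Suc n))" using s(1) by (simp add: shd_less_imp_less)
    moreover have "s 0 \<le> u"
    proof -
      have "pad z [] \<le> stl u"
        using u sconst_le[of "stl u" A z] min
        by (cases u) (simp add: pad_def cylinder_def streams_Stream)
      moreover have "i \<le> shd u" using u i(2) by (simp add: cylinder_def)
      ultimately show ?thesis using s(2) by (cases u) (auto simp: pad_Cons)
    qed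
    ultimately show "u \<in> {u \<in> streams A. (\<exists>m. s m \<le> u) \<and> (\<exists>n. u < s n)}"
      using u by (auto simp: cylinder_def)
  qed
  \<comment> \<open>Nothing precedes the first \<tau>, so no odd copy is cut off at index 0.\<close>
  define s where "s n = (if n \<le> 0 then pad z [i] else pad z [a n, z, x, a n])" for n
  define t where "t n = pad z [a n]" for n
  have shd_st: "shd (s n) = a n" "shd (t n) = a n" for n
    using a0 by (simp_all add: s_def t_def pad_Cons)
  have "s m \<le> s n \<and> t m \<le> t n" if "m \<le> n" for m n
  proof (cases "m = n \<or> n \<le> 0")
    case True
    then show ?thesis using that a0 by (auto simp: s_def t_def)
  next
    case False
    then have "a m < a n" using that by (intro a_less) auto
    then show ?thesis using shd_st shd_less_imp_less less_imp_le by metis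
  qed
  then have "mono s" "mono t" by (auto intro: monoI)
  moreover have "parity_iso True (stream_interval A (s n) (s (n + 1))) (stream_interval A (t n) (t (n + 1)))"
    for n
  proof -
    consider "n < 0" | "n = 0" | "n > 0" by linarith
    then show ?thesis
    proof cases
      case 1
      have "parity_iso True {} {}" by (auto simp: parity_iso_def order_iso_def)
      then show ?thesis using 1 a0 by (simp add: s_def t_def stream_interval_empty)
    next
      case 2
      have "parity_iso True (stream_interval A (pad z [i]) (pad z [a 1, z, x, a 1]))
          (stream_interval A (pad z [i]) (pad z [a 1]))"
        by (rule parity_iso_pad_block[OF zx(1,2) _ aA zx(3) _ parity_iso_refl])
          (use a_less[of 0 1] a0[of 0] aA[of 0] in \<open>auto simp: pad_Cons\<close>)
      then show ?thesis using 2 a0 by (simp add: s_def t_def)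
    next
      case 3
      have "parity_iso True (stream_interval A (pad z [a n, z, x, a n])
            (pad z [a (n + 1), z, x, a (n + 1)]))
          (stream_interval A (pad z [a n]) (pad z [a (n + 1)]))"
        by (rule parity_iso_pad_block[OF zx(1,2) aA aA zx(3) _ parity_iso_pad_final])
          (use a_less[of n "n + 1"] 3 aA zx in \<open>auto simp: pad_Cons\<close>)
      then show ?thesis using 3 by (simp add: s_def t_def)
    qed
  qed
  ultimately have "parity_iso True {u \<in> streams A. (\<exists>m. s m \<le> u) \<and> (\<exists>n. u < s n)}
      {u \<in> streams A. (\<exists>m. t m \<le> u) \<and> (\<exists>n. u < t n)}"
    by (rule parity_iso_int_blocks)
  moreover have "s 0 = pad z [i]" "t 0 = pad z [i]" using a0 by (simp_all add: s_def t_def)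
  ultimately show ?thesis using cyl[of s] cyl[of t] shd_st by simp
qed

section \<open>From the members of the cover to all of A^\<omega>\<close>

lemma parity_reversing_automorphism_iff:
  "(\<exists>f. parity_reversing_automorphism A f) \<longleftrightarrow> parity_iso True (streams A) (streams A)"
proof -
  \<comment> \<open>The letter \<open>shd u\<close> shows that the quantifier over \<open>a\<close>
    is not vacuous.\<close>
  have "(\<forall>a\<in>A. f u \<sim>\<^sub>2 a ## u) \<longleftrightarrow> tail_parity True u (f u)" if "u \<in> streams A" for f u
    using shd_in[OF that] by (auto simp: sim2_SCons_iff)
  then show ?thesis
    unfolding parity_reversing_automorphism_def parity_iso_def by auto
qed

lemma interval_of_separated:
  assumes "interval_of A I" "interval_of A J" "I \<inter> J = {}"
  shows "(\<forall>p\<in>I. \<forall>q\<in>J. p < q) \<or> (\<forall>p\<in>I. \<forall>q\<in>J. q < p)"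
proof (rule ccontr)
  assume "\<not> ?thesis"
  \<comment> \<open>The two violations place either \<open>p'\<close> between points of
    \<open>J\<close> or \<open>q\<close> between points of \<open>I\<close>.\<close>
  then obtain p q p' q' where *: "p \<in> I" "q \<in> J" "q \<le> p" "p' \<in> I" "q' \<in> J" "p' \<le> q'"
    by (auto simp: not_less)
  have "I \<subseteq> A" "J \<subseteq> A" using assms(1,2) by (auto simp: interval_of_def)
  show False
  proof (cases "q \<le> p'")
    case True
    then have "p' \<in> J" using * \<open>I \<subseteq> A\<close> assms(2) unfolding interval_of_def by blast
    then show False using * assms(3) by blast
  next
    case False
    then have "p' \<le> q" by simp
    then have "q \<in> I" using * \<open>J \<subseteq> A\<close> assms(1) unfolding interval_of_def by blast
    then show False using * assms(3) by blast
  qed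
qed

lemma parity_iso_streams_cover:
  assumes C: "cover_of A C" and iso: "\<And>I. I \<in> C \<Longrightarrow> parity_iso b (cylinder A I) (cylinder A I)"
  shows "parity_iso b (streams A) (streams A)"
proof -
  have "parity_iso b (\<Union>I\<in>C. cylinder A I) (\<Union>I\<in>C. cylinder A I)"
  proof (rule parity_iso_UN[OF iso])
    fix I J assume "I \<in> C" "J \<in> C" "I \<noteq> J"
    then have "(\<forall>p\<in>I. \<forall>q\<in>J. p < q) \<or> (\<forall>p\<in>I. \<forall>q\<in>J. q < p)"
      using C by (intro interval_of_separated[of A]) (auto simp: cover_of_def disjoint_def)
    then have "(\<forall>u\<in>cylinder A I. \<forall>v\<in>cylinder A J. u < v) \<or>
        (\<forall>u\<in>cylinder A I. \<forall>v\<in>cylinder A J. v < u)"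
    proof (elim disjE)
      assume "\<forall>p\<in>I. \<forall>q\<in>J. p < q"
      then show ?thesis by (intro disjI1) (simp add: cylinder_def shd_less_imp_less)
    next
      assume "\<forall>p\<in>I. \<forall>q\<in>J. q < p"
      then show ?thesis by (intro disjI2) (simp add: cylinder_def shd_less_imp_less)
    qed
    then show "(\<forall>u\<in>cylinder A I. \<forall>v\<in>cylinder A J. u < v) \<and> (\<forall>u\<in>cylinder A I. \<forall>v\<in>cylinder A J. u < v) \<or>
        (\<forall>u\<in>cylinder A I. \<forall>v\<in>cylinder A J. v < u) \<and> (\<forall>u\<in>cylinder A I. \<forall>v\<in>cylinder A J. v < u)"
      by simp
  qed
  moreover have "(\<Union>I\<in>C. cylinder A I) = streams A"
    using C shd_in[of _ A] by (auto simp: cylinder_def cover_of_def)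
  ultimately show ?thesis by simp
qed

lemma cofinality_omega_greater:
  assumes "cofinality_omega I" "y \<in> I"
  shows "\<exists>w\<in>I. y < w"
proof -
  obtain c :: "nat \<Rightarrow> 'a" where c: "strict_mono c" "range c \<subseteq> I" "\<forall>y\<in>I. \<exists>n. y \<le> c n"
    using assms(1) unfolding cofinality_omega_def by blast
  obtain n where "y \<le> c n" using c(3) assms(2) by blast
  also have "c n < c (Suc n)" using c(1) by (simp add: strict_mono_less)
  finally show ?thesis using c(2) by blast
qed

text \<open>Source of the letter \<open>x\<close> above \<open>z\<close>: no member of the cover has
  a last element.\<close>

lemma Z_omega_cover_greater:
  assumes "Z_omega_cover A C" "y \<in> A"
  shows "\<exists>w\<in>A. y < w"
proof -
  obtain I where I: "I \<in> C" "y \<in> I"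
    using assms by (auto simp: Z_omega_cover_def cover_of_def)
  then have "cofinality_omega I"
    using assms(1) by (auto simp: Z_omega_cover_def Z_interval_def omega_interval_def)
  then obtain w where "w \<in> I" "y < w" using cofinality_omega_greater I(2) by blast
  then show ?thesis using assms(1) I(1) by (auto simp: Z_omega_cover_def cover_of_def)
qed

lemma Z_cover_imp_parity_iso:
  assumes C: "Z_cover A C"
  shows "parity_iso True (streams A) (streams A)"
proof (rule parity_iso_streams_cover)
  show "cover_of A C" using C by (simp add: Z_cover_def)
  fix I assume I: "I \<in> C"
  then have ZI: "Z_interval A I" using C by (simp add: Z_cover_def)
  then have "I \<noteq> {}" "I \<subseteq> A"
    by (auto simp: Z_interval_def interval_of_def cofinality_omega_def)
  then obtain z where "z \<in> A" by blast
  moreover have "Z_omega_cover A C" using C by (simp add: Z_cover_def Z_omega_cover_def)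
  ultimately obtain x where "x \<in> A" "z < x" using Z_omega_cover_greater by blast
  then show "parity_iso True (cylinder A I) (cylinder A I)"
    using parity_iso_cylinder_Z[OF \<open>z \<in> A\<close> _ _ ZI] by blast
qed

lemma Z_omega_cover_imp_parity_iso:
  assumes C: "Z_omega_cover A C" and A: "has_minimum A"
  shows "parity_iso True (streams A) (streams A)"
proof (rule parity_iso_streams_cover)
  show "cover_of A C" using C by (simp add: Z_omega_cover_def)
  obtain z where z: "z \<in> A" "\<And>y. y \<in> A \<Longrightarrow> z \<le> y"
    using A by (auto simp: has_minimum_def)
  obtain x where x: "x \<in> A" "z < x" using Z_omega_cover_greater[OF C z(1)] by blast
  fix I assume "I \<in> C"
  then consider "Z_interval A I" | "omega_interval A I" using C by (auto simp: Z_omega_cover_def)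
  then show "parity_iso True (cylinder A I) (cylinder A I)"
  proof cases
    case 1
    then show ?thesis by (rule parity_iso_cylinder_Z[OF z(1) x])
  next
    case 2
    then show ?thesis using parity_iso_cylinder_omega[OF z(1) x z(2)] by blast
  qed
qed

section \<open>Order reversal\<close>

instance dual :: (linorder) linorder
  by standard (auto simp: dual_less_eq_iff)

text \<open>Dualizing the letters keeps the position of the first difference and reverses the
  comparison there.\<close>

lemma smap_dual_less_iff: "smap dual u < smap dual v \<longleftrightarrow> v < (u :: 'a::linorder stream)"
proof -
  have "less_fun (snth (smap dual u)) (snth (smap dual v)) \<longleftrightarrow> less_fun (snth v) (snth u)"
    unfolding less_fun_def by auto
  then show ?thesis by (simp add: less_stream_def)
qed

lemma smap_undual_less_iff: "smap undual u < smap undual v \<longleftrightarrow> v < (u :: 'a::linorder dual stream)"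
  using smap_dual_less_iff[of "smap undual v" "smap undual u"] by (simp add: stream.map_comp stream.map_id)

lemma tail_parity_smap: "tail_parity b u v \<Longrightarrow> tail_parity b (smap h u) (smap h v)"
  unfolding tail_parity_def by (metis sdrop_smap)

text \<open>Conjugation with letterwise dualization: the two reversals cancel, and parity survives
  because \<open>smap\<close> commutes with dropping letters.\<close>

lemma parity_iso_of_dual:
  fixes A :: "'a::linorder set"
  assumes "parity_iso b (streams (dual ` A)) (streams (dual ` A))"
  shows "parity_iso b (streams A) (streams A)"
proof -
  obtain f where f: "order_iso f (streams (dual ` A)) (streams (dual ` A))"
    and fp: "\<forall>u\<in>streams (dual ` A). tail_parity b u (f u)"
    using assms unfolding parity_iso_def by blast
  have down: "smap undual u \<in> streams A" if "u \<in> streams (dual ` A)" for u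
    by (rule smap_streams[OF that]) auto
  have up: "smap dual u \<in> streams (dual ` A)" if "u \<in> streams A" for u
    by (rule smap_streams[OF that]) auto
  define g where "g u = smap undual (f (smap dual u))" for u
  have "order_iso g (streams A) (streams A)"
  proof (rule order_isoI)
    show "g u \<in> streams A" if "u \<in> streams A" for u
      using down order_iso_mem[OF f] up[OF that] by (simp add: g_def)
    show "\<exists>u\<in>streams A. g u = v" if v: "v \<in> streams A" for v
    proof -
      obtain u where u: "u \<in> streams (dual ` A)" "f u = smap dual v"
        using order_iso_onto[OF f up[OF v]] by blast
      then have "g (smap undual u) = v"
        by (simp add: g_def stream.map_comp stream.map_id)
      then show ?thesis using down[OF u(1)] by blast
    qed
    show "g u < g v" if "u \<in> streams A" "v \<in> streams A" "u < v" for u v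
      using that order_iso_less[OF f] up by (simp add: g_def smap_undual_less_iff smap_dual_less_iff)
  qed
  moreover have "tail_parity b u (g u)" if "u \<in> streams A" for u
    using tail_parity_smap[OF fp[rule_format, OF up[OF that]], of undual]
    by (simp add: g_def stream.map_comp stream.map_id)
  ultimately show ?thesis unfolding parity_iso_def by blast
qed

lemma interval_of_dual: "interval_of (dual ` A) (dual ` I) \<longleftrightarrow> interval_of A I"
  unfolding interval_of_def by (auto simp: image_subset_iff)

lemma has_minimum_dual: "has_minimum (dual ` I) \<longleftrightarrow> has_maximum I"
  by (auto simp: has_minimum_def has_maximum_def)

lemma has_maximum_dual: "has_maximum (dual ` I) \<longleftrightarrow> has_minimum I"
  by (auto simp: has_minimum_def has_maximum_def)

lemma cofinality_omega_dual:
  assumes "coinitiality_omega I"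
  shows "cofinality_omega (dual ` I)"
proof -
  obtain d :: "nat \<Rightarrow> 'a" where "strict_antimono_on UNIV d" "range d \<subseteq> I" "\<forall>y\<in>I. \<exists>n. d n \<le> y"
    using assms unfolding coinitiality_omega_def by blast
  then show ?thesis
    unfolding cofinality_omega_def
    by (intro exI[of _ "\<lambda>n. dual (d n)"]) (auto simp: monotone_on_def)
qed

lemma coinitiality_omega_dual:
  assumes "cofinality_omega I"
  shows "coinitiality_omega (dual ` I)"
proof -
  obtain c :: "nat \<Rightarrow> 'a" where "strict_mono c" "range c \<subseteq> I" "\<forall>y\<in>I. \<exists>n. y \<le> c n"
    using assms unfolding cofinality_omega_def by blast
  then show ?thesis
    unfolding coinitiality_omega_def
    by (intro exI[of _ "\<lambda>n. dual (c n)"]) (auto simp: monotone_on_def)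
qed

text \<open>Reduces the third case to the second, as reversal exchanges minima with maxima and
  cofinality with coinitiality.\<close>

lemma Z_omega_star_cover_dual:
  assumes "Z_omega_star_cover A C"
  shows "Z_omega_cover (dual ` A) ((`) dual ` C)"
proof -
  have C: "\<forall>I\<in>C. interval_of A I" "disjoint C" "\<Union>C = A"
    using assms by (auto simp: Z_omega_star_cover_def cover_of_def)
  have "disjoint ((`) dual ` C)"
    using C(2) unfolding disjoint_def by (auto simp del: image_Int simp: image_Int[OF inj_dual, symmetric])
  then have "cover_of (dual ` A) ((`) dual ` C)"
    using C(1,3) by (auto simp: cover_of_def interval_of_dual)
  moreover have "Z_interval (dual ` A) (dual ` I) \<or> omega_interval (dual ` A) (dual ` I)"
    if "I \<in> C" for I
    using assms that unfolding Z_omega_star_cover_def Z_interval_def omega_interval_def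
      omega_star_interval_def
    by (auto simp: interval_of_dual has_minimum_dual has_maximum_dual cofinality_omega_dual
        coinitiality_omega_dual)
  ultimately show ?thesis by (auto simp: Z_omega_cover_def)
qed

section \<open>Fibres over the infinite power\<close>

text \<open>The address of \<open>x\<close> under repeated expansion of X into A^2 X: each
  application of \<open>h\<close> emits two letters and passes on the remainder.\<close>

definition itinerary :: "('x \<Rightarrow> ('a \<times> 'a) \<times> 'x) \<Rightarrow> 'x \<Rightarrow> 'a stream" where
  "itinerary h x = flat (smap (\<lambda>y. [fst (fst (h y)), snd (fst (h y))]) (siterate (\<lambda>y. snd (h y)) x))"

lemma itinerary_unfold:
  "itinerary h x = fst (fst (h x)) ## snd (fst (h x)) ## itinerary h (snd (h x))"
  unfolding itinerary_def by (subst siterate.ctr) simp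

text \<open>Induction on the position of the first difference: \<open>h\<close> itself decides
  positions 0 and 1, the remainders decide later ones, two places earlier. Hence the itinerary is
  weakly increasing and the fibres are convex.\<close>

lemma itinerary_less_imp_less:
  assumes h: "order_iso h X ((A \<times> A) \<times> X)" and "x \<in> X" "y \<in> X" "itinerary h x < itinerary h y"
  shows "x < y"
proof -
  have "x < y" if "\<forall>k<n. itinerary h x !! k = itinerary h y !! k" "itinerary h x !! n < itinerary h y !! n"
    "x \<in> X" "y \<in> X" for n x y
    using that
  proof (induction n arbitrary: x y rule: less_induct)
    case (less n)
    obtain a b x' where x': "h x = ((a, b), x')" by (metis prod.exhaust)
    obtain c d y' where y': "h y = ((c, d), y')" by (metis prod.exhaust)
    have X: "x' \<in> X" "y' \<in> X" using order_iso_mem[OF h] less.prems(3,4) x' y' by fastforce+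
    have ix: "itinerary h x = a ## b ## itinerary h x'" "itinerary h y = c ## d ## itinerary h y'"
      using itinerary_unfold[of h x] itinerary_unfold[of h y] x' y' by auto
    consider "n = 0" | "n = 1" | m where "n = Suc (Suc m)"
      by (metis One_nat_def not0_implies_Suc)
    then have "h x < h y"
    proof cases
      case 1
      then show ?thesis using less.prems(2) ix x' y' by simp
    next
      case 2
      then have "a = c" using less.prems(1) ix by force
      then show ?thesis using 2 less.prems(2) ix x' y' by simp
    next
      case 3
      have ab: "a = c" "b = d"
        using less.prems(1)[rule_format, of 0] less.prems(1)[rule_format, of 1] ix 3 by auto
      have "x' < y'"
      proof (rule less.IH[of m])
        show "\<forall>k<m. itinerary h x' !! k = itinerary h y' !! k"
        proof (intro allI impI)
          fix k assume "k < m"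
          then show "itinerary h x' !! k = itinerary h y' !! k"
            using less.prems(1)[rule_format, of "Suc (Suc k)"] ix 3 by simp
        qed
      qed (use 3 ix less.prems X in simp_all)
      then show ?thesis using ab x' y' by simp
    qed
    then show ?case using order_iso_less[OF h] less.prems(3,4) by blast
  qed
  then show ?thesis using assms unfolding less_stream_def less_fun_def by blast
qed

lemma itinerary_in_streams:
  assumes h: "order_iso h X ((A \<times> A) \<times> X)" and "x \<in> X"
  shows "itinerary h x \<in> streams A"
proof -
  have "itinerary h x !! n \<in> A" if "x \<in> X" for n x
    using that
  proof (induction n arbitrary: x rule: less_induct)
    case (less n)
    have hx: "h x \<in> (A \<times> A) \<times> X" using order_iso_mem[OF h less.prems] .
    consider "n = 0" | "n = 1" | m where "n = Suc (Suc m)"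
      by (metis One_nat_def not0_implies_Suc)
    then show ?case
    proof cases
      case 3
      have "itinerary h x !! n = itinerary h (snd (h x)) !! m"
        by (subst itinerary_unfold) (simp add: 3)
      then show ?thesis using less.IH[of m "snd (h x)"] hx 3 by auto
    qed (subst itinerary_unfold, use hx in auto)+
  qed
  then show ?thesis using assms(2) by (simp add: streams_iff_snth)
qed

definition fibre :: "('x \<Rightarrow> ('a \<times> 'a) \<times> 'x) \<Rightarrow> 'x set \<Rightarrow> 'a stream \<Rightarrow> 'x set" where
  "fibre h X u = {x \<in> X. itinerary h x = u}"

text \<open>On this fibre the first component of \<open>h\<close> is constantly
  \<open>(a, b)\<close>, so dropping it preserves the order.\<close>

lemma fibre_sdrop2:
  assumes h: "order_iso h X ((A \<times> A) \<times> X)" and u: "a ## b ## u \<in> streams A"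
  shows "fibre h X (a ## b ## u) \<cong>\<^sub>o fibre h X u"
proof -
  have hx: "\<exists>x'\<in>X. h x = ((a, b), x') \<and> itinerary h x' = u" if "x \<in> fibre h X (a ## b ## u)" for x
    using that order_iso_mem[OF h, of x] itinerary_unfold[of h x] by (cases "h x") (auto simp: fibre_def)
  have "order_iso (\<lambda>x. snd (h x)) (fibre h X (a ## b ## u)) (fibre h X u)"
  proof (rule order_isoI)
    show "snd (h x) \<in> fibre h X u" if "x \<in> fibre h X (a ## b ## u)" for x
      using hx[OF that] by (auto simp: fibre_def)
    show "\<exists>x\<in>fibre h X (a ## b ## u). snd (h x) = y" if y: "y \<in> fibre h X u" for y
    proof -
      have "((a, b), y) \<in> (A \<times> A) \<times> X" using y u by (simp add: fibre_def streams_Stream)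
      then obtain x where x: "x \<in> X" "h x = ((a, b), y)" using order_iso_onto[OF h] by blast
      then have "x \<in> fibre h X (a ## b ## u)"
        using y itinerary_unfold[of h x] by (simp add: fibre_def)
      then show ?thesis using x by force
    qed
    show "snd (h x) < snd (h y)"
      if xy: "x \<in> fibre h X (a ## b ## u)" "y \<in> fibre h X (a ## b ## u)" "x < y" for x y
    proof -
      have "h x < h y" using xy order_iso_less[OF h] by (simp add: fibre_def)
      then show ?thesis using hx[OF xy(1)] hx[OF xy(2)] by auto
    qed
  qed
  then show ?thesis unfolding order_isomorphic_def by blast
qed

lemma fibre_sdrop_even:
  assumes h: "order_iso h X ((A \<times> A) \<times> X)" and "u \<in> streams A"
  shows "fibre h X u \<cong>\<^sub>o fibre h X (sdrop (2 * k) u)"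
  using assms(2)
proof (induction k arbitrary: u)
  case 0
  then show ?case by (simp add: order_isomorphic_refl)
next
  case (Suc k)
  obtain a b v where u: "u = a ## b ## v" by (metis stream.exhaust)
  then have "fibre h X u \<cong>\<^sub>o fibre h X v" using fibre_sdrop2[OF h] Suc.prems by blast
  moreover have "fibre h X v \<cong>\<^sub>o fibre h X (sdrop (2 * k) v)"
    using Suc u by (simp add: streams_Stream)
  ultimately show ?case using u order_isomorphic_trans by fastforce
qed

lemma fibre_tail_parity:
  assumes h: "order_iso h X ((A \<times> A) \<times> X)"
    and uv: "u \<in> streams A" "v \<in> streams A" "tail_parity False u v"
  shows "fibre h X u \<cong>\<^sub>o fibre h X v"
proof -
  obtain m n where mn: "sdrop m u = sdrop n v" "even (m + n)"
    using uv(3) unfolding tail_parity_def by blast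
  \<comment> \<open>Fibres are compared along steps of two letters; if \<open>m\<close> and
    \<open>n\<close> are odd, one further letter is dropped on both sides.\<close>
  have "\<exists>m n. sdrop m u = sdrop n v \<and> even m \<and> even n"
  proof (cases "even m")
    case True
    then show ?thesis using mn by auto
  next
    case False
    then have "even (Suc m)" "even (Suc n)" using mn(2) by auto
    moreover have "sdrop (Suc m) u = sdrop (Suc n) v" using mn(1) by (metis sdrop.simps(2) sdrop_stl)
    ultimately show ?thesis by blast
  qed
  then obtain k l where "sdrop (2 * k) u = sdrop (2 * l) v" by (auto elim!: evenE)
  then show ?thesis
    using fibre_sdrop_even[OF h uv(1), of k] fibre_sdrop_even[OF h uv(2), of l]
    by (metis order_isomorphic_sym order_isomorphic_trans)
qed

lemma parity_iso_imp_square_root: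
  fixes A :: "'a::linorder set" and X :: "'x::linorder set"
  assumes "parity_iso True (streams A) (streams A)" "(A \<times> A) \<times> X \<cong>\<^sub>o X"
  shows "A \<times> X \<cong>\<^sub>o X"
proof -
  obtain h where h: "order_iso h X ((A \<times> A) \<times> X)"
    using order_isomorphic_sym[OF assms(2)] unfolding order_isomorphic_def by blast
  obtain f where f: "order_iso f (streams A) (streams A)"
    and fp: "\<And>u. u \<in> streams A \<Longrightarrow> tail_parity True u (f u)"
    using assms(1) unfolding parity_iso_def by blast
  have stl_in: "stl u \<in> streams A" if "u \<in> streams A" for u
    using that by (cases u) (simp add: streams_Stream)
  \<comment> \<open>The odd change made by \<open>f\<close> and the loss of one letter add up to an
    even change.\<close>
  have "fibre h X u \<cong>\<^sub>o fibre h X (stl (f u))" if u: "u \<in> streams A" for u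
  proof (rule fibre_tail_parity[OF h u stl_in[OF order_iso_mem[OF f u]]])
    have "tail_parity True (stl (f u)) (f u)"
      using tail_parity_shift[of "[shd (f u)]" "stl (f u)"] by simp
    then show "tail_parity False u (stl (f u))"
      using tail_parity_trans[OF fp[OF u] tail_parity_sym] by fastforce
  qed
  then obtain g where g: "\<And>u. u \<in> streams A \<Longrightarrow> order_iso (g u) (fibre h X u) (fibre h X (stl (f u)))"
    unfolding order_isomorphic_def by metis
  let ?\<phi> = "itinerary h"
  have \<phi>: "?\<phi> x \<in> streams A" "x \<in> fibre h X (?\<phi> x)" if "x \<in> X" for x
    using itinerary_in_streams[OF h that] that by (auto simp: fibre_def)
  have gX: "g (?\<phi> x) x \<in> X" "?\<phi> (g (?\<phi> x) x) = stl (f (?\<phi> x))" if "x \<in> X" for x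
    using order_iso_mem[OF g[OF \<phi>(1)[OF that]] \<phi>(2)[OF that]] by (auto simp: fibre_def)
  \<comment> \<open>The fibre of A X over a v is {a} times the fibre of X over v; \<open>F\<close>
    sends the fibre over u to the one over f(u).\<close>
  define F where "F x = (shd (f (?\<phi> x)), g (?\<phi> x) x)" for x
  have "order_iso F X (A \<times> X)"
  proof (rule order_isoI)
    show "F x \<in> A \<times> X" if "x \<in> X" for x
      using gX(1)[OF that] shd_in[OF order_iso_mem[OF f \<phi>(1)[OF that]]] by (simp add: F_def)
    show "\<exists>x\<in>X. F x = p" if p: "p \<in> A \<times> X" for p
    proof -
      obtain a y where ay: "p = (a, y)" "a \<in> A" "y \<in> X" using p by blast
      then have "a ## ?\<phi> y \<in> streams A" using \<phi>(1) by (simp add: streams_Stream)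
      then obtain u where u: "u \<in> streams A" "f u = a ## ?\<phi> y" using order_iso_onto[OF f] by blast
      then have "y \<in> fibre h X (stl (f u))" using ay by (simp add: fibre_def)
      then obtain x where "x \<in> fibre h X u" "g u x = y" using order_iso_onto[OF g[OF u(1)]] by blast
      then show ?thesis using u ay by (auto simp: F_def fibre_def intro!: bexI[of _ x])
    qed
    show "F x < F y" if xy: "x \<in> X" "y \<in> X" "x < y" for x y
    proof -
      have "\<not> ?\<phi> y < ?\<phi> x" using itinerary_less_imp_less[OF h xy(2,1)] xy(3) by auto
      then consider "?\<phi> x = ?\<phi> y" | "?\<phi> x < ?\<phi> y" by fastforce
      then show ?thesis
      proof cases
        case 1
        then have "g (?\<phi> x) x < g (?\<phi> x) y"
          using order_iso_less[OF g[OF \<phi>(1)[OF xy(1)]], of x y] xy by (simp add: fibre_def)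
        then show ?thesis using 1 by (simp add: F_def)
      next
        case 2
        then have "f (?\<phi> x) < f (?\<phi> y)" using order_iso_less[OF f] \<phi>(1) xy by blast
        then consider "shd (f (?\<phi> x)) < shd (f (?\<phi> y))"
          | "shd (f (?\<phi> x)) = shd (f (?\<phi> y))" "stl (f (?\<phi> x)) < stl (f (?\<phi> y))"
          using less_stream_iff by blast
        then show ?thesis
        proof cases
          case 2
          \<comment> \<open>With equal heads, the tails are the itineraries of the two images and
            decide their order.\<close>
          then have "g (?\<phi> x) x < g (?\<phi> y) y"
            using itinerary_less_imp_less[OF h gX(1) gX(1)] gX(2) xy by metis
          then show ?thesis using 2 by (simp add: F_def)
        qed (simp add: F_def)
      qed
    qed
  qed
  then show ?thesis using order_isomorphic_sym unfolding order_isomorphic_def by blast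
qed

theorem theorem4p4:
  fixes A :: "'a::linorder set" and X :: "'x::linorder set"
  shows "((\<exists>C. Z_cover A C) \<longrightarrow> (\<exists>f. parity_reversing_automorphism A f)) \<and>
    (has_minimum A \<and> (\<exists>C. Z_omega_cover A C) \<longrightarrow>
      (\<exists>f. parity_reversing_automorphism A f)) \<and>
    (has_maximum A \<and> (\<exists>C. Z_omega_star_cover A C) \<longrightarrow>
      (\<exists>f. parity_reversing_automorphism A f)) \<and>
    ((\<exists>C. Z_cover A C) \<or>
      (has_minimum A \<and> (\<exists>C. Z_omega_cover A C)) \<or>
      (has_maximum A \<and> (\<exists>C. Z_omega_star_cover A C)) \<longrightarrow>
      (A \<times> A) \<times> X \<cong>\<^sub>o X \<longrightarrow> A \<times> X \<cong>\<^sub>o X)"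
proof -
  \<comment> \<open>The third case is the second one for the reversed order, whose minimum is the
    maximum of \<open>A\<close>.\<close>
  have "parity_iso True (streams A) (streams A)" if "has_maximum A" "Z_omega_star_cover A C" for C
    using parity_iso_of_dual[OF Z_omega_cover_imp_parity_iso[OF Z_omega_star_cover_dual]] that
    by (simp add: has_minimum_dual)
  then show ?thesis
    unfolding parity_reversing_automorphism_iff
    using Z_cover_imp_parity_iso Z_omega_cover_imp_parity_iso parity_iso_imp_square_root by blast
qed

end
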